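(* Let $A \in \mathbb{C}^{n\times n}$ be a nonsingular normal matrix, let $b \in \mathbb{C}^n$, and let $1 \le m \le n-1$. Let $r_0, r_1, \dots, r_q$ be the sequence of residual vectors produced by GMRES($m$) applied to the system $Ax=b$, where $q$ is the total number of GMRES($m$) cycles, and suppose that all of these residual vectors are nonzero. Then $$\frac{\| r_{k} \|}{\| r_{k-1} \|} \leq \frac{\| r_{k+1} \|}{\| r_k \|}, \qquad k = 1, \dots, q-1.$$
   Context: $\|\cdot\|$ is the Euclidean norm on $\mathbb{C}^n$. For $r\in\mathbb{C}^n$ and $m \ge 1$, the $m$-dimensional Krylov subspace is $\mathcal{K}_m(A,r) = \mathrm{span}\{r, Ar, \dots, A^{m-1}r\}$. Restarted GMRES, written GMRES($m$), with restart parameter $m$, works (in exact arithmetic) in cycles: starting from the initial residual $r_0 = b - Ax_0$, where $x_0$ is an initial approximate solution, the $k$-th cycle ($k = 1, \dots, q$) takes the residual $r_{k-1}$ and produces the residual vector $r_k$, which is the unique vector of minimal norm in the affine space $r_{k-1} + A\mathcal{K}_m(A,r_{k-1})$, i.e. $\|r_k\| = \min_{u \in \mathcal{K}_m(A,r_{k-1})} \|r_{k-1} - Au\|$ with $r_k = r_{k-1}-Au$ for a minimizing $u$. *)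

theory Defs
  imports "HOL-Analysis.Analysis"
begin

definition conj_transpose :: "complex^'n^'m \<Rightarrow> complex^'m^'n" where
  "conj_transpose A = (\<chi> i j. cnj (A $ j $ i))"

definition normal_matrix :: "complex^'n^'n \<Rightarrow> bool" where
  "normal_matrix A \<longleftrightarrow> A ** conj_transpose A = conj_transpose A ** A"

(* vec.span is the span over the scalar field, here the complex numbers;
   the unqualified span would only give real linear combinations. *)
definition krylov :: "complex^'n^'n \<Rightarrow> complex^'n \<Rightarrow> nat \<Rightarrow> (complex^'n) set" where
  "krylov A r m = vec.span ((\<lambda>i. (((*v) A) ^^ i) r) ` {..<m})"

(* norm on complex^'n is the Euclidean norm. The minimal residual r' is unique,
   so this relation is functional in r'. *)
definition gmres_cycle ::
  "complex^'n^'n \<Rightarrow> nat \<Rightarrow> complex^'n \<Rightarrow> complex^'n \<Rightarrow> bool" where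
  "gmres_cycle A m r r' \<longleftrightarrow>
     (\<exists>u \<in> krylov A r m. r' = r - A *v u \<and>
        (\<forall>v \<in> krylov A r m. norm (r - A *v u) \<le> norm (r - A *v v)))"

(* The first q + 1 entries of r are the residuals of q cycles started at x0;
   later entries are unconstrained. *)
definition gmres_residuals ::
  "complex^'n^'n \<Rightarrow> complex^'n \<Rightarrow> complex^'n \<Rightarrow> nat \<Rightarrow> nat \<Rightarrow> (nat \<Rightarrow> complex^'n) \<Rightarrow> bool" where
  "gmres_residuals A b x0 m q r \<longleftrightarrow>
     r 0 = b - A *v x0 \<and> (\<forall>k \<in> {1..q}. gmres_cycle A m (r (k - 1)) (r k))"

end

theory Submission
  imports Defs
begin

text \<open>
  Write \<open>r'' = q(A) r'\<close> with \<open>q\<close> of degree at most \<open>m\<close> and \<open>q(0) = 1\<close>. Minimality makes \<open>r'\<close>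
  orthogonal to \<open>A K\<^sub>m(A, r)\<close>, so \<open>\<langle>r', q(A) r\<rangle> = \<langle>r', r\<rangle> = \<parallel>r'\<parallel>\<^sup>2\<close>. Moving \<open>q(A)\<close> to the other
  side and applying Cauchy-Schwarz gives \<open>\<parallel>r'\<parallel>\<^sup>2 \<le> \<parallel>q(A)\<^sup>* r'\<parallel> \<parallel>r\<parallel>\<close>. Since \<open>q(A)\<close> is normal,
  \<open>\<parallel>q(A)\<^sup>* r'\<parallel> = \<parallel>q(A) r'\<parallel> = \<parallel>r''\<parallel>\<close>. The real inner product, which is the real part of the
  Hermitian one, suffices throughout.
\<close>

lemma inner_conj_transpose:
  fixes A :: "complex^'n^'m"
  shows "(conj_transpose A *v x) \<bullet> y = x \<bullet> (A *v y)"
proof -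
  have "(conj_transpose A *v x) \<bullet> y = (\<Sum>i\<in>UNIV. \<Sum>j\<in>UNIV. (cnj (A $ j $ i) * x $ j) \<bullet> y $ i)"
    by (simp add: inner_vec_def conj_transpose_def matrix_vector_mult_def inner_sum_left)
  also have "\<dots> = (\<Sum>i\<in>UNIV. \<Sum>j\<in>UNIV. x $ j \<bullet> (A $ j $ i * y $ i))"
    by (intro sum.cong refl) (simp add: inner_complex_def algebra_simps)
  also have "\<dots> = (\<Sum>j\<in>UNIV. \<Sum>i\<in>UNIV. x $ j \<bullet> (A $ j $ i * y $ i))"
    by (rule sum.swap)
  also have "\<dots> = x \<bullet> (A *v y)"
    by (simp add: inner_vec_def matrix_vector_mult_def inner_sum_right)
  finally show ?thesis .
qed

lemma conj_transpose_conj_transpose [simp]: "conj_transpose (conj_transpose A) = A"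
  by (simp add: conj_transpose_def vec_eq_iff)

lemma conj_transpose_mult:
  "conj_transpose (A ** B) = conj_transpose B ** conj_transpose A"
  by (simp add: conj_transpose_def matrix_matrix_mult_def vec_eq_iff mult.commute)

text \<open>Moving the matrix across the inner product turns the two squared norms into the
  quadratic forms of \<open>A ** conj_transpose A\<close> and \<open>conj_transpose A ** A\<close>,
  which normality identifies.\<close>

lemma norm_conj_transpose_mult_normal:
  assumes "normal_matrix A"
  shows "norm (conj_transpose A *v x) = norm (A *v x)"
proof -
  have "(conj_transpose A *v x) \<bullet> (conj_transpose A *v x) = x \<bullet> ((A ** conj_transpose A) *v x)"
    by (simp add: inner_conj_transpose matrix_vector_mul_assoc)
  also have "\<dots> = x \<bullet> ((conj_transpose A ** A) *v x)"
    using assms by (simp add: normal_matrix_def)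
  also have "\<dots> = (A *v x) \<bullet> (A *v x)"
    by (metis conj_transpose_conj_transpose inner_conj_transpose matrix_vector_mul_assoc)
  finally show ?thesis by (simp add: norm_eq_sqrt_inner)
qed

text \<open>The bicommutant stands in for the polynomials in \<open>A\<close>.\<close>

definition bicommutant :: "complex^'n^'n \<Rightarrow> (complex^'n^'n) set" where
  "bicommutant A = {C. \<forall>D. D ** A = A ** D \<longrightarrow> D ** C = C ** D}"

text \<open>By normality the adjoint of \<open>A\<close> commutes with \<open>A\<close>, hence with
  \<open>B\<close>. Taking adjoints, the adjoint of \<open>B\<close> commutes with \<open>A\<close>,
  and so, by the bicommutant property again, with \<open>B\<close>.\<close>

lemma normal_matrix_bicommutant:
  assumes "normal_matrix A" and B: "B \<in> bicommutant A"
  shows "normal_matrix B"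
proof -
  have "conj_transpose A ** B = B ** conj_transpose A"
    using assms by (auto simp: bicommutant_def normal_matrix_def)
  then have "conj_transpose (conj_transpose A ** B) = conj_transpose (B ** conj_transpose A)"
    by simp
  then have "conj_transpose B ** A = A ** conj_transpose B"
    by (simp add: conj_transpose_mult)
  then show ?thesis
    using B by (auto simp: bicommutant_def normal_matrix_def)
qed

lemma bicommutant_self: "A \<in> bicommutant A"
  by (simp add: bicommutant_def)

lemma bicommutant_mat: "mat c \<in> bicommutant A"
  by (simp add: bicommutant_def matrix_matrix_mult_def mat_def vec_eq_iff if_distrib
      if_distribR sum.delta mult.commute cong: if_cong)

lemma bicommutant_add: "B \<in> bicommutant A \<Longrightarrow> C \<in> bicommutant A \<Longrightarrow> B + C \<in> bicommutant A"
  by (simp add: bicommutant_def matrix_matrix_mult_def vec_eq_iff ring_distribs sum.distrib)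

lemma bicommutant_diff: "B \<in> bicommutant A \<Longrightarrow> C \<in> bicommutant A \<Longrightarrow> B - C \<in> bicommutant A"
  by (simp add: bicommutant_def matrix_matrix_mult_def vec_eq_iff left_diff_distrib
      right_diff_distrib sum_subtractf)

lemma bicommutant_mult: "B \<in> bicommutant A \<Longrightarrow> C \<in> bicommutant A \<Longrightarrow> B ** C \<in> bicommutant A"
  unfolding bicommutant_def mem_Collect_eq
proof (intro allI impI)
  fix D
  assume "\<forall>D. D ** A = A ** D \<longrightarrow> D ** B = B ** D" "\<forall>D. D ** A = A ** D \<longrightarrow> D ** C = C ** D"
    and "D ** A = A ** D"
  then have "D ** B = B ** D" "D ** C = C ** D" by blast+
  then show "D ** (B ** C) = (B ** C) ** D" by (metis matrix_mul_assoc)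
qed

lemma mat_vector_mult: "mat c *v x = c *s (x :: complex^'n)"
  by (simp add: matrix_vector_mult_def mat_def vec_eq_iff if_distrib if_distribR sum.delta
      cong: if_cong)

lemma funpow_matrix_vector_mult:
  "\<exists>C \<in> bicommutant A. \<forall>y. ((*v) A ^^ i) y = C *v y"
proof (induction i)
  case 0
  show ?case by (rule bexI[of _ "mat 1"]) (simp_all add: bicommutant_mat)
next
  case (Suc i)
  then obtain C where "C \<in> bicommutant A" "\<forall>y. ((*v) A ^^ i) y = C *v y" by blast
  then show ?case
    by (intro bexI[of _ "A ** C"])
      (simp_all add: matrix_vector_mul_assoc bicommutant_mult bicommutant_self)
qed

text \<open>The matrix \<open>C\<close> plays the role of p(A) with p of degree below
  \<open>m\<close>. It is fixed before \<open>y\<close>, so a polynomial found for one starting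
  vector can be applied to another.\<close>

lemma krylov_polynomial:
  assumes "u \<in> krylov A x m"
  shows "\<exists>C \<in> bicommutant A. u = C *v x \<and> (\<forall>y. C *v y \<in> krylov A y m)"
  using assms unfolding krylov_def
proof (induction rule: vec.span_induct_alt)
  case base
  show ?case
    using bicommutant_mat[of 0 A] by (intro bexI[of _ 0]) (simp_all add: vec.span_zero)
next
  case (step c z w)
  then obtain C where C: "C \<in> bicommutant A" "w = C *v x"
    "\<forall>y. C *v y \<in> vec.span ((\<lambda>i. ((*v) A ^^ i) y) ` {..<m})" by blast
  from step obtain i where i: "i < m" "z = ((*v) A ^^ i) x" by auto
  obtain D where D: "D \<in> bicommutant A" "\<forall>y. ((*v) A ^^ i) y = D *v y"
    using funpow_matrix_vector_mult by blast
  have D_span: "D *v y \<in> vec.span ((\<lambda>i. ((*v) A ^^ i) y) ` {..<m})" for y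
    using i(1) D(2) by (metis imageI lessThan_iff vec.span_base)
  have eq: "(mat c ** D + C) *v y = c *s (D *v y) + C *v y" for y
    by (simp add: matrix_vector_mult_add_rdistrib matrix_vector_mul_assoc[symmetric]
        mat_vector_mult)
  show ?case
  proof (intro bexI conjI allI)
    show "c *s z + w = (mat c ** D + C) *v x" using eq C(2) D(2) i(2) by simp
    show "(mat c ** D + C) *v y \<in> vec.span ((\<lambda>i. ((*v) A ^^ i) y) ` {..<m})" for y
      unfolding eq using C(3) D_span by (blast intro: vec.span_add vec.span_scale)
    show "mat c ** D + C \<in> bicommutant A"
      by (intro bicommutant_add bicommutant_mult bicommutant_mat C D)
  qed
qed

text \<open>A complex span is also closed under real scaling, which makes the real theory of closest
  points applicable.\<close>

lemma subspace_krylov: "subspace (krylov A r m)"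
proof -
  have eq: "c *\<^sub>R x = complex_of_real c *s x" for c and x :: "complex^'n"
    unfolding vec_eq_iff by (simp only: vector_scaleR_component vector_smult_component)
      (simp add: scaleR_conv_of_real)
  then show ?thesis
    unfolding krylov_def subspace_def
    by (simp add: eq vec.span_zero vec.span_add vec.span_scale)
qed

lemma closest_subspace_orthogonal:
  fixes x :: "'a::euclidean_space"
  assumes S: "subspace S" "x \<in> S" "w \<in> S" and min: "\<forall>z\<in>S. norm (a - x) \<le> norm (a - z)"
  shows "(a - x) \<bullet> w = 0"
proof -
  \<comment> \<open>The variational inequality for the closest point of a closed convex set. In a
    subspace both \<open>x + w\<close> and \<open>x - w\<close> are admissible, which forces
    equality.\<close>
  have le: "(a - x) \<bullet> (y - x) \<le> 0" if "y \<in> S" for y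
    using any_closest_point_dot[OF subspace_imp_convex closed_subspace] that assms
    by (simp add: dist_norm)
  show ?thesis
    using le[of "x + w"] le[of "x - w"] S by (simp add: subspace_add subspace_diff)
qed

text \<open>The minimizing \<open>A *v u\<close> is the point closest to \<open>r\<close> in the
  image of the Krylov space under \<open>A\<close>.\<close>

lemma gmres_cycle_orthogonal:
  assumes "gmres_cycle A m r r'" and "v \<in> krylov A r m"
  shows "r' \<bullet> (A *v v) = 0"
proof -
  obtain u where u: "u \<in> krylov A r m" "r' = r - A *v u"
    "\<forall>v \<in> krylov A r m. norm (r - A *v u) \<le> norm (r - A *v v)"
    using assms(1) by (auto simp: gmres_cycle_def)
  have "subspace ((*v) A ` krylov A r m)"
    by (intro linear_subspace_image subspace_krylov matrix_vector_mul_linear)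
  then show ?thesis
    unfolding u(2) using u assms(2) by (intro closest_subspace_orthogonal) auto
qed

lemma gmres_cycle_norm_le:
  assumes A: "normal_matrix A" and "gmres_cycle A m r r'" and "gmres_cycle A m r' r''"
  shows "(norm r')\<^sup>2 \<le> norm r'' * norm r"
proof -
  obtain u where u: "u \<in> krylov A r m" "r' = r - A *v u"
    using assms(2) by (auto simp: gmres_cycle_def)
  obtain v where v: "v \<in> krylov A r' m" "r'' = r' - A *v v"
    using assms(3) by (auto simp: gmres_cycle_def)
  obtain C where C: "C \<in> bicommutant A" "v = C *v r'" "\<forall>y. C *v y \<in> krylov A y m"
    using krylov_polynomial[OF v(1)] by blast
  \<comment> \<open>This is q(A) for q(z) = 1 - z p(z), where \<open>C\<close> stands for p(A); it
    maps \<open>r'\<close> to \<open>r''\<close>.\<close>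
  define B where "B = mat 1 - A ** C"
  have B: "B *v y = y - A *v (C *v y)" for y
    by (simp add: B_def matrix_vector_mult_diff_rdistrib matrix_vector_mul_assoc)
  have "B \<in> bicommutant A"
    unfolding B_def by (intro bicommutant_diff bicommutant_mult bicommutant_mat bicommutant_self C)
  then have "normal_matrix B" by (rule normal_matrix_bicommutant[OF A])
  have orth: "r' \<bullet> (A *v w) = 0" if "w \<in> krylov A r m" for w
    using gmres_cycle_orthogonal[OF assms(2) that] .
  have "(norm r')\<^sup>2 = r' \<bullet> r - r' \<bullet> (A *v u)"
    unfolding power2_norm_eq_inner by (metis inner_diff_right u(2))
  \<comment> \<open>Both subtracted terms vanish by orthogonality: the polynomial of the second
    cycle, applied to \<open>r\<close>, stays in the Krylov space of the first.\<close>
  also have "\<dots> = r' \<bullet> r - r' \<bullet> (A *v (C *v r))"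
    using orth u(1) C(3) by simp
  also have "\<dots> = (conj_transpose B *v r') \<bullet> r"
    by (simp add: inner_conj_transpose B inner_diff_right)
  also have "\<dots> \<le> norm (conj_transpose B *v r') * norm r"
    by (rule norm_cauchy_schwarz)
  also have "norm (conj_transpose B *v r') = norm r''"
    using norm_conj_transpose_mult_normal[OF \<open>normal_matrix B\<close>] B C(2) v(2) by simp
  finally show ?thesis .
qed

theorem theorem5:
  fixes A :: "complex^'n^'n" and b x0 :: "complex^'n"
    and m q :: nat and r :: "nat \<Rightarrow> complex^'n"
  assumes "invertible A" and "normal_matrix A"
    and "1 \<le> m" and "m \<le> CARD('n) - 1"
    and "gmres_residuals A b x0 m q r"
    and "\<forall>k \<in> {0..q}. r k \<noteq> 0"
  shows "\<forall>k \<in> {1..q - 1}. norm (r k) / norm (r (k - 1)) \<le> norm (r (k + 1)) / norm (r k)"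
proof
  fix k assume k: "k \<in> {1..q - 1}"
  have cyc: "gmres_cycle A m (r (j - 1)) (r j)" if "j \<in> {1..q}" for j
    using assms(5) that by (simp add: gmres_residuals_def)
  \<comment> \<open>Since \<open>k\<close> is at least 1, the truncated difference
    \<open>q - 1\<close> is positive, so \<open>k + 1\<close> is at most \<open>q\<close>.\<close>
  have "k \<in> {1..q}" "k + 1 \<in> {1..q}" using k by auto
  then have "gmres_cycle A m (r (k - 1)) (r k)" "gmres_cycle A m (r k) (r (k + 1))"
    using cyc[of k] cyc[of "k + 1"] by simp_all
  then have "(norm (r k))\<^sup>2 \<le> norm (r (k + 1)) * norm (r (k - 1))"
    by (rule gmres_cycle_norm_le[OF assms(2)])
  moreover have "norm (r k) > 0" "norm (r (k - 1)) > 0"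
    using assms(6) k by auto
  ultimately show "norm (r k) / norm (r (k - 1)) \<le> norm (r (k + 1)) / norm (r k)"
    by (simp add: divide_simps power2_eq_square)
qed

end
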